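(* Let $F$ be a (finite, simple) forest with maximum degree $\Delta\ge 3$, and let $m\in\mathbb{N}$. Then the game colouring number of the $m$-th power $F^m$ satisfies \[\mathrm{col}_g(F^m)\le\frac{(\Delta-1)^m-1}{\Delta-2}+2^m+1.\]
   Context: All graphs are finite, simple and loopless. For a graph $G=(V,E)$ and $m\in\mathbb{N}$, the $m$-th power $G^m$ is the graph on vertex set $V$ in which two distinct vertices $v,w$ are adjacent if and only if $1\le \mathrm{dist}_G(v,w)\le m$, where $\mathrm{dist}_G$ is the usual shortest-path distance in $G$ (so $G^1=G$ and $G^0$ has no edges). The marking game on a graph $G=(V,E)$: two players, Alice and Bob, alternately mark previously unmarked vertices of $G$, Alice moving first, until every vertex is marked. This produces a linear ordering $\le$ of $V$ (the order in which vertices are marked). The back degree of $v$ is $bd_\le(v)=|\{w\in V: vw\in E,\ w\le v\}|$, and the score is $sc(G,\le)=1+\max_{v\in V} bd_\le(v)$. Alice tries to minimize the score and Bob tries to maximize it; the game colouring number $\mathrm{col}_g(G)$ is the score obtained when both players play optimally (equivalently, the smallest $s$ such that Alice has a strategy guaranteeing score at most $s$). *)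

theory Defs
  imports "Graph_Theory.Graph_Theory"
begin

text \<open>
  A finite simple loopless graph is a \<^locale>\<open>pair_graph\<close>: a finite vertex set together with a
  finite, symmetric, irreflexive set of arcs, an edge \<open>vw\<close> being the pair of arcs \<open>(v, w)\<close>, \<open>(w, v)\<close>.
\<close>

text \<open>
  The constant \<^const>\<open>forest\<close> of the library forbids all directed cycles, including the walk
  \<open>u, v, u\<close> along a single edge, so no symmetric digraph with an edge satisfies it. Cycles of
  undirected graphs have length at least 3.
\<close>

definition is_forest :: "'a pair_pre_digraph \<Rightarrow> bool" where
  "is_forest G \<longleftrightarrow> pair_graph G \<and>
     \<not> (\<exists>p. pre_digraph.cycle (with_proj G) p \<and> 3 \<le> length p)"

text \<open>The maximum degree and the score below are given the usual values 0 and 1 on the empty graph.\<close>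

definition max_degree :: "'a pair_pre_digraph \<Rightarrow> nat" where
  "max_degree G = Max (insert 0 (out_degree (with_proj G) ` pverts G))"

text \<open>The distance is \<open>\<infinity>\<close> between vertices of different components.\<close>

definition graph_dist :: "'a pair_pre_digraph \<Rightarrow> 'a \<Rightarrow> 'a \<Rightarrow> ereal" where
  "graph_dist G v w = wf_digraph.\<mu> (with_proj G) (\<lambda>_. 1) v w"

definition graph_power :: "'a pair_pre_digraph \<Rightarrow> nat \<Rightarrow> 'a pair_pre_digraph" where
  "graph_power G m =
     \<lparr> pverts = pverts G,
       parcs = {(v, w). v \<in> pverts G \<and> w \<in> pverts G \<and> v \<noteq> w \<and>
                  1 \<le> graph_dist G v w \<and> graph_dist G v w \<le> ereal (real m)} \<rparr>"

definition back_degree :: "'a pair_pre_digraph \<Rightarrow> 'a rel \<Rightarrow> 'a \<Rightarrow> nat" where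
  "back_degree G r v = card {w \<in> pverts G. (v, w) \<in> parcs G \<and> (w, v) \<in> r}"

definition score :: "'a pair_pre_digraph \<Rightarrow> 'a rel \<Rightarrow> nat" where
  "score G r = 1 + Max (insert 0 (back_degree G r ` pverts G))"

text \<open>
  A position of the marking game is the list of the vertices marked so far, in the order of
  marking; Alice is to move if and only if its length is even.
\<close>

definition marking_order :: "'a list \<Rightarrow> 'a rel" where
  "marking_order xs = {(xs ! i, xs ! j) | i j. i \<le> j \<and> j < length xs}"

definition alice_strategy :: "'a set \<Rightarrow> ('a list \<Rightarrow> 'a) \<Rightarrow> bool" where
  "alice_strategy V \<sigma> \<longleftrightarrow>
     (\<forall>xs. distinct xs \<and> set xs \<subset> V \<and> even (length xs) \<longrightarrow> \<sigma> xs \<in> V - set xs)"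

definition complete_play :: "'a set \<Rightarrow> ('a list \<Rightarrow> 'a) \<Rightarrow> 'a list \<Rightarrow> bool" where
  "complete_play V \<sigma> xs \<longleftrightarrow> distinct xs \<and> set xs = V \<and>
     (\<forall>i < length xs. even i \<longrightarrow> xs ! i = \<sigma> (take i xs))"

definition alice_guarantees :: "'a pair_pre_digraph \<Rightarrow> nat \<Rightarrow> bool" where
  "alice_guarantees G s \<longleftrightarrow>
     (\<exists>\<sigma>. alice_strategy (pverts G) \<sigma> \<and>
        (\<forall>xs. complete_play (pverts G) \<sigma> xs \<longrightarrow> score G (marking_order xs) \<le> s))"

definition game_col :: "'a pair_pre_digraph \<Rightarrow> nat" where
  "game_col G = (LEAST s. alice_guarantees G s)"

lemma pair_graph_graph_power:
  assumes "pair_graph G"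
  shows "pair_graph (graph_power G m)"
proof -
  interpret pair_graph G by fact
  have le: "graph_dist G w v \<le> graph_dist G v w" for v w
  proof -
    have "graph_dist G w v \<le> ereal (awalk_cost (\<lambda>_. 1) p)" if "awalk v p w" for p
    proof -
      have "awalk w (rev_path p) v" using that by simp
      moreover have "awalk_cost (\<lambda>_. 1) (rev_path p) = awalk_cost (\<lambda>_. 1) p"
        by (induction p) (auto simp: awalk_cost_def)
      ultimately show ?thesis
        unfolding graph_dist_def by (metis min_cost_le_walk_cost)
    qed
    then show ?thesis
      unfolding graph_dist_def[of G v w] \<mu>_def by (auto intro: INF_greatest)
  qed
  have eq: "graph_dist G v w = graph_dist G w v" for v w
    by (intro antisym le)
  have "finite (parcs (graph_power G m))"
    by (rule finite_subset[of _ "pverts G \<times> pverts G"]) (auto simp: graph_power_def)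
  then show ?thesis
    by unfold_locales (auto simp: graph_power_def symmetric_def sym_def eq)
qed

lemma alice_guarantees_game_col:
  assumes "finite (pverts G)"
  shows "alice_guarantees G (game_col G)"
proof -
  define \<sigma> where "\<sigma> = (\<lambda>xs. SOME x. x \<in> pverts G - set xs)"
  have "alice_strategy (pverts G) \<sigma>"
    unfolding alice_strategy_def \<sigma>_def by (metis (no_types, lifting) Diff_eq_empty_iff all_not_in_conv psubsetE someI_ex)
  moreover have "score G r \<le> 1 + card (pverts G)" for r
    using assms by (auto simp: score_def back_degree_def intro!: card_mono)
  ultimately have "alice_guarantees G (1 + card (pverts G))"
    by (auto simp: alice_guarantees_def)
  then show ?thesis
    unfolding game_col_def by (rule LeastI)
qed

end

theory Submission
  imports Defs
begin

text \<open>
  Root the forest and let Alice play an activation strategy. Each newly marked vertex starts a walk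
  towards the root which activates inactive vertices, passes through marked ones, and stops at the
  first vertex that is active and still unmarked; Alice marks that vertex. Hence an unmarked vertex
  lets at most one walk through, and a marked vertex receives at most one more walk than it emits.
  By induction on the depth, a vertex that has emitted \<open>e\<close> walks has at most \<open>e (2 ^ (d + 1) - 1)\<close>
  marked vertices at depth at most \<open>d\<close> of its subtree. So an unmarked vertex \<open>v\<close> has at most
  \<open>2 ^ m - 1\<close> marked descendants within distance \<open>m\<close> after a move of Alice, and at most \<open>2 ^ m\<close>
  after the next move of Bob. All other vertices within distance \<open>m\<close> of \<open>v\<close> are reached through
  its parent, and there are at most \<open>\<Sum>i<m. (\<Delta> - 1) ^ i\<close> of them.
\<close>

section \<open>Branches\<close>

text \<open>
  The ends of the walks of length at most \<open>d\<close> from \<open>u\<close> that never return along the arc just used,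
  the arc used to enter \<open>u\<close> being the one from \<open>x\<close>.
\<close>

fun branch :: "('a \<Rightarrow> 'a set) \<Rightarrow> nat \<Rightarrow> 'a \<Rightarrow> 'a \<Rightarrow> 'a set" where
  "branch N 0 x u = {u}"
| "branch N (Suc d) x u = insert u (\<Union>y\<in>N u - {x}. branch N d u y)"

lemma finite_branch:
  assumes "\<And>u. finite (N u)"
  shows "finite (branch N d x u)"
  using assms by (induction d arbitrary: x u) auto

text \<open>Since \<open>x\<close> is itself a neighbour of \<open>u\<close>, at most
  \<open>k\<close> continuations remain, which gives the geometric sum. Symmetry of \<open>N\<close>
  passes this on: \<open>u\<close> is a neighbour of the next vertex.\<close>

lemma card_branch_le:
  assumes fin: "\<And>u. finite (N u)"
    and sym: "\<And>u y. y \<in> N u \<Longrightarrow> u \<in> N y"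
    and deg: "\<And>u. card (N u) \<le> Suc k"
    and "x \<in> N u"
  shows "card (branch N d x u) \<le> (\<Sum>i\<le>d. k ^ i)"
  using \<open>x \<in> N u\<close>
proof (induction d arbitrary: x u)
  case 0
  then show ?case by simp
next
  case (Suc d)
  have "card (\<Union>y\<in>N u - {x}. branch N d u y) \<le> (\<Sum>y\<in>N u - {x}. card (branch N d u y))"
    using fin by (intro card_UN_le) auto
  also have "\<dots> \<le> card (N u - {x}) * (\<Sum>i\<le>d. k ^ i)"
    using Suc.IH sym by (intro sum_bounded_above[where K = "\<Sum>i\<le>d. k ^ i", simplified]) auto
  also have "\<dots> \<le> k * (\<Sum>i\<le>d. k ^ i)"
    using deg[of u] fin[of u] Suc.prems by (intro mult_right_mono) auto
  finally have "card (branch N (Suc d) x u) \<le> Suc (k * (\<Sum>i\<le>d. k ^ i))"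
    using fin by (auto simp: card_insert_if finite_branch)
  also have "\<dots> = (\<Sum>i\<le>Suc d. k ^ i)"
    by (simp add: sum.atMost_Suc_shift sum_distrib_left del: sum.atMost_Suc)
  finally show ?case .
qed

section \<open>Activation in a rooted forest\<close>

text \<open>\<open>rk\<close> need not be the depth: its strict decrease towards the root makes the
  parent map acyclic and supports induction along walks.\<close>

locale rooted_forest =
  fixes V :: "'a set" and par :: "'a \<Rightarrow> 'a option" and rk :: "'a \<Rightarrow> nat"
  assumes finite_V: "finite V"
    and par_in_V: "x \<in> V \<Longrightarrow> par x = Some y \<Longrightarrow> y \<in> V"
    and rk_par: "x \<in> V \<Longrightarrow> par x = Some y \<Longrightarrow> rk y < rk x"
begin

definition children :: "'a \<Rightarrow> 'a set" where
  "children y = {c \<in> V. par c = Some y}"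

definition nbs :: "'a \<Rightarrow> 'a set" where
  "nbs x = {y \<in> V. x \<in> V \<and> (par x = Some y \<or> par y = Some x)}"

lemma finite_children: "finite (children y)" and finite_nbs: "finite (nbs x)"
  using finite_V by (auto simp: children_def nbs_def)

lemma nbs_sym: "y \<in> nbs x \<Longrightarrow> x \<in> nbs y"
  by (auto simp: nbs_def)

text \<open>Hence a branch entered from the parent stays in the subtree. The ranks exclude that
  \<open>x\<close> is also a child of \<open>c\<close>.\<close>

lemma nbs_minus_parent:
  assumes "c \<in> V" "par c = Some x"
  shows "nbs c - {x} = children c"
  using assms rk_par[of c x] rk_par[of x c] par_in_V by (auto simp: nbs_def children_def)

text \<open>
  \<open>e x\<close> counts the activation walks that have left \<open>x\<close> towards its parent; \<open>x\<close> is active if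
  \<open>e x > 0\<close>. A pending walk \<open>q = Some y\<close> has entered \<open>y\<close> from a child but not been processed there.
\<close>

definition activation :: "'a option \<Rightarrow> ('a \<Rightarrow> nat) \<Rightarrow> 'a set \<Rightarrow> bool" where
  "activation q e M \<longleftrightarrow> M \<subseteq> V \<and>
     (\<forall>y\<in>V. sum e (children y) \<le> e y + of_bool (y \<in> M) + of_bool (q = Some y)) \<and>
     (\<forall>y\<in>M. e y \<ge> 1) \<and> (\<forall>y\<in>V - M. e y \<le> 1)"

text \<open>The invariant that Alice restores with each move; the counts are hidden because the game
  records only marks.\<close>

definition settled :: "'a set \<Rightarrow> bool" where
  "settled M \<longleftrightarrow> (\<exists>e. activation None e M)"

lemma activation_empty: "activation None (\<lambda>_. 0) {}"
  by (simp add: activation_def)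

lemma activation_pending: "activation None e M \<Longrightarrow> activation (Some x) e M"
  by (fastforce simp: activation_def)

lemma activation_insert:
  assumes "activation None e M" "x \<in> V" "e x \<ge> 1"
  shows "activation None e (insert x M)"
proof -
  have "sum e (children y) \<le> e y + of_bool (y \<in> insert x M)" if "y \<in> V" for y
  proof -
    have "sum e (children y) \<le> e y + of_bool (y \<in> M)"
      using that assms(1) by (simp add: activation_def)
    then show ?thesis
      by auto
  qed
  then show ?thesis
    using assms by (auto simp: activation_def)
qed

text \<open>
  The walk climbs through marked and inactive vertices, raising \<open>e\<close> by one at each of them; it ends
  beyond a root or at the first unmarked active vertex, which is then marked.
\<close>

lemma activation_walk:
  assumes "activation (Some x) e M" "x \<in> V"
  shows "\<exists>e' M'. activation None e' M' \<and> (M' = M \<or> (\<exists>u\<in>V - M. M' = insert u M)) \<and>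
           (\<forall>y. e y \<le> e' y) \<and> e' x \<ge> 1"
  using assms
proof (induction "rk x" arbitrary: x e rule: less_induct)
  case less
  show ?case
  proof (cases "x \<in> M \<or> e x = 0")
    case True
    \<comment> \<open>The walk passes \<open>x\<close>: raising \<open>e x\<close> pays for its
      arrival there, and it becomes pending at the parent.\<close>
    define e' where "e' = e(x := Suc (e x))"
    have e': "e y \<le> e' y" "e' x \<ge> 1" for y
      by (auto simp: e'_def)
    have sum_e': "sum e' (children y) = sum e (children y) + of_bool (par x = Some y)" for y
    proof (cases "par x = Some y")
      case True
      then have "x \<in> children y"
        using less.prems by (simp add: children_def)
      then show ?thesis
        using True finite_children[of y] unfolding e'_def
        by (simp add: sum.remove[of _ x] cong: sum.cong_simp)
    next
      case False
      then have "x \<notin> children y"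
        by (simp add: children_def)
      then show ?thesis
        using False unfolding e'_def by (auto intro!: sum.cong)
    qed
    have act: "activation (par x) e' M"
      unfolding activation_def
    proof (intro conjI ballI)
      show "M \<subseteq> V"
        using less.prems by (simp add: activation_def)
      fix y
      {
        assume "y \<in> V"
        then have "sum e (children y) \<le> e y + of_bool (y \<in> M) + of_bool (x = y)"
          using less.prems by (simp add: activation_def)
        then show "sum e' (children y) \<le> e' y + of_bool (y \<in> M) + of_bool (par x = Some y)"
          unfolding sum_e' by (auto simp: e'_def)
      }
      show "e' y \<ge> 1" if "y \<in> M"
        using that less.prems by (auto simp: activation_def e'_def)
      \<comment> \<open>An unmarked \<open>x\<close> is passed only when inactive, so its count
        rises from 0 to 1.\<close>
      show "e' y \<le> 1" if "y \<in> V - M"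
        using that less.prems True by (auto simp: activation_def e'_def)
    qed
    show ?thesis
    proof (cases "par x")
      case None
      then show ?thesis
        using act e' by auto
    next
      case (Some y)
      with less.hyps[of y e'] less.prems act
      obtain e'' M' where "activation None e'' M'" "M' = M \<or> (\<exists>u\<in>V - M. M' = insert u M)"
        "\<forall>y. e' y \<le> e'' y"
        by (metis rk_par par_in_V)
      then show ?thesis
        using e' order_trans by (intro exI[of _ e''] exI[of _ M']) blast
    qed
  next
    case False
    \<comment> \<open>The walk stops at \<open>x\<close>: the unit granted by marking
      \<open>x\<close> replaces that of the pending walk.\<close>
    have "sum e (children y) \<le> e y + of_bool (y \<in> insert x M)" if "y \<in> V" for y
    proof -
      have "sum e (children y) \<le> e y + of_bool (y \<in> M) + of_bool (x = y)"
        using that less.prems by (simp add: activation_def)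
      then show ?thesis
        using False by auto
    qed
    then have "activation None e (insert x M)"
      using False less.prems by (auto simp: activation_def)
    then show ?thesis
      using False less.prems by (intro exI[of _ e] exI[of _ "insert x M"]) auto
  qed
qed

text \<open>A pending walk only weakens the inequality at \<open>x\<close>, so a walk may start
  there, and it leaves \<open>x\<close> active. If it ends beyond a root or at \<open>x\<close>
  itself, \<open>x\<close> can be marked alone; otherwise it ends at another vertex
  \<open>u\<close>.\<close>

lemma settled_walk:
  assumes "settled M" "x \<in> V - M"
  shows "settled (insert x M) \<or>
         (\<exists>u\<in>V - insert x M. settled (insert u M) \<and> settled (insert u (insert x M)))"
proof -
  from assms obtain e where "activation None e M"
    by (auto simp: settled_def)
  with activation_walk[OF activation_pending] assms(2)
  obtain e' M' where e': "activation None e' M'" "M' = M \<or> (\<exists>u\<in>V - M. M' = insert u M)" "e' x \<ge> 1"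
    by blast
  then have ins: "activation None e' (insert x M')"
    using assms(2) by (intro activation_insert) auto
  show ?thesis
  proof (cases "M' = M \<or> M' = insert x M")
    case True
    then show ?thesis
      using ins by (auto simp: settled_def)
  next
    case False
    then obtain u where "u \<in> V - insert x M" "M' = insert u M"
      using e'(2) by auto
    then show ?thesis
      using e'(1) ins by (auto simp: settled_def insert_commute)
  qed
qed

text \<open>A free move: Alice starts a walk at any unmarked \<open>x\<close> and marks
  \<open>x\<close> or the vertex \<open>u\<close> where the walk stops.\<close>

lemma settled_alice:
  assumes "settled M" "M \<noteq> V"
  shows "\<exists>u\<in>V - M. settled (insert u M)"
proof -
  have "M \<subseteq> V"
    using assms(1) by (auto simp: settled_def activation_def)
  then obtain x where "x \<in> V - M"
    using assms(2) by blast
  then show ?thesis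
    using settled_walk[OF assms(1)] by blast
qed

text \<open>Alice marks the vertex where the walk from Bob's \<open>x\<close> stops; if that yields
  no new vertex, the position is already settled and she has a free move.\<close>

lemma settled_bob_alice:
  assumes "settled M" "x \<in> V - M" "insert x M \<noteq> V"
  shows "\<exists>u\<in>V - insert x M. settled (insert u (insert x M))"
  using settled_walk[OF assms(1,2)] settled_alice[of "insert x M"] assms(3) by blast

text \<open>The children of \<open>c\<close> emit at most \<open>e c + 1\<close> walks if
  \<open>c\<close> is marked and \<open>e c\<close> otherwise, so at most \<open>2 * e c\<close>:
  the bound doubles per level. The summand \<open>e c\<close> avoids subtraction.\<close>

lemma card_marked_branch:
  assumes "activation None e M" "c \<in> V" "par c = Some x"
  shows "card (M \<inter> branch nbs d x c) + e c \<le> e c * 2 ^ Suc d"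
  using assms(2,3)
proof (induction d arbitrary: c x)
  case 0
  then show ?case
    using assms(1) by (cases "c \<in> M") (auto simp: activation_def)
next
  case (Suc d)
  let ?E = "sum e (children c)"
  have E: "?E \<le> e c + of_bool (c \<in> M)" and pos: "c \<in> M \<Longrightarrow> e c \<ge> 1"
    using assms(1) Suc.prems by (auto simp: activation_def)
  let ?B = "\<Union>y\<in>children c. M \<inter> branch nbs d c y"
  have "card ?B + ?E \<le> (\<Sum>y\<in>children c. card (M \<inter> branch nbs d c y)) + ?E"
    using finite_children by (intro add_right_mono card_UN_le)
  also have "\<dots> = (\<Sum>y\<in>children c. card (M \<inter> branch nbs d c y) + e y)"
    by (simp add: sum.distrib)
  also have "\<dots> \<le> (\<Sum>y\<in>children c. e y * 2 ^ Suc d)"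
    using Suc.IH by (intro sum_mono) (auto simp: children_def)
  also have "\<dots> = ?E * 2 ^ Suc d"
    by (simp add: sum_distrib_right)
  finally have B: "card ?B + ?E \<le> ?E * 2 ^ Suc d" .
  have "M \<inter> branch nbs (Suc d) x c = (M \<inter> {c}) \<union> ?B"
    using nbs_minus_parent[OF Suc.prems] by auto
  then have "card (M \<inter> branch nbs (Suc d) x c) \<le> card (M \<inter> {c}) + card ?B"
    by (simp add: card_Un_le)
  also have "card (M \<inter> {c}) = of_bool (c \<in> M)"
    by simp
  finally have le: "card (M \<inter> branch nbs (Suc d) x c) \<le> of_bool (c \<in> M) + card ?B" .
  obtain p where p: "(2::nat) ^ Suc d = Suc p"
    by (metis gr0_implies_Suc zero_less_numeral zero_less_power)
  have B': "card ?B \<le> ?E * p"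
    using B unfolding p by simp
  have "?E * p \<le> (e c + of_bool (c \<in> M)) * p"
    using E by (intro mult_right_mono) auto
  \<comment> \<open>A marked \<open>c\<close> costs itself and one extra incoming walk; both are
    charged to \<open>e c\<close>, which is then positive.\<close>
  moreover have "of_bool (c \<in> M) * Suc p \<le> e c * Suc p"
    using pos by (intro mult_right_mono) auto
  ultimately have "of_bool (c \<in> M) + card ?B + e c \<le> e c * (2 * Suc p)"
    using B' by (simp add: algebra_simps)
  then show ?case
    using le p by simp
qed

lemma card_marked_near:
  assumes "settled M" "v \<in> V - M" and deg: "\<And>u. card (nbs u) \<le> Suc k"
  shows "Suc (card (M \<inter> (\<Union>y\<in>nbs v. branch nbs d v y))) \<le> (\<Sum>i\<le>d. k ^ i) + 2 ^ Suc d"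
proof -
  from assms obtain e where act: "activation None e M"
    by (auto simp: settled_def)
  let ?E = "sum e (children v)"
  let ?C = "\<Union>y\<in>children v. M \<inter> branch nbs d v y"
  let ?P = "\<Union>y\<in>nbs v - children v. branch nbs d v y"
  \<comment> \<open>The unmarked \<open>v\<close> receives no more walks than it emits, hence at
    most one.\<close>
  have "?E \<le> e v + of_bool (v \<in> M)" "e v \<le> 1"
    using act assms(2) by (auto simp: activation_def)
  then have E: "?E \<le> 1"
    using assms(2) by simp
  have "card ?C + ?E \<le> (\<Sum>y\<in>children v. card (M \<inter> branch nbs d v y)) + ?E"
    using finite_children by (intro add_right_mono card_UN_le)
  also have "\<dots> = (\<Sum>y\<in>children v. card (M \<inter> branch nbs d v y) + e y)"
    by (simp add: sum.distrib)
  also have "\<dots> \<le> (\<Sum>y\<in>children v. e y * 2 ^ Suc d)"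
    using card_marked_branch[OF act] by (intro sum_mono) (auto simp: children_def)
  also have "\<dots> = ?E * 2 ^ Suc d"
    by (simp add: sum_distrib_right)
  finally have "card ?C + ?E \<le> ?E * 2 ^ Suc d" .
  then have C: "Suc (card ?C) \<le> 2 ^ Suc d"
    using E by (cases "?E = 0") (auto simp: le_Suc_eq)
  \<comment> \<open>On the parent side all vertices are counted, marked or not.\<close>
  have "card ?P \<le> (\<Sum>i\<le>d. k ^ i)"
  proof (cases "par v")
    case None
    then have "nbs v - children v = {}"
      by (auto simp: nbs_def children_def)
    then show ?thesis
      by (simp only: UN_empty card.empty)
  next
    case (Some p)
    then have "nbs v - children v \<subseteq> {p}" "p \<in> nbs v"
      using assms(2) par_in_V by (auto simp: nbs_def children_def)
    then have "?P \<subseteq> branch nbs d v p"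
      by blast
    then have "card ?P \<le> card (branch nbs d v p)"
      by (intro card_mono finite_branch finite_nbs)
    also have "\<dots> \<le> (\<Sum>i\<le>d. k ^ i)"
      using \<open>p \<in> nbs v\<close> by (intro card_branch_le finite_nbs deg) (auto intro: nbs_sym)
    finally show ?thesis .
  qed
  moreover have "card (M \<inter> (\<Union>y\<in>nbs v. branch nbs d v y)) \<le> card (?C \<union> ?P)"
    by (intro card_mono) (auto intro: finite_branch finite_nbs finite_children)
  moreover have "card (?C \<union> ?P) \<le> card ?C + card ?P"
    by (rule card_Un_le)
  ultimately show ?thesis
    using C by linarith
qed

end

section \<open>Rooting a forest\<close>

text \<open>Take a longest path inside \<open>S\<close>. A second neighbour in \<open>S\<close> of
  its first vertex would extend the path or close a cycle.\<close>

lemma forest_has_leaf: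
  assumes "is_forest F" "S \<subseteq> pverts F" "S \<noteq> {}"
  shows "\<exists>x\<in>S. \<forall>y\<in>S. \<forall>z\<in>S. (x, y) \<in> parcs F \<longrightarrow> (x, z) \<in> parcs F \<longrightarrow> y = z"
proof (rule ccontr)
  assume "\<not> ?thesis"
  then have two: "\<exists>y\<in>S. y \<noteq> z \<and> (x, y) \<in> parcs F" if "x \<in> S" for x z
    using that by metis
  interpret pair_graph F
    using assms(1) by (simp add: is_forest_def)
  define L where "L n \<longleftrightarrow> (\<exists>u p v. apath u p v \<and> set (awalk_verts u p) \<subseteq> S \<and> length p = n)" for n
  from assms obtain x where "x \<in> S" "x \<in> pverts F"
    by auto
  then have "apath x [] x"
    by (simp add: apath_Nil_iff)
  then have "L 0"
    using \<open>x \<in> S\<close> unfolding L_def by force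
  moreover have "n \<le> card (pverts F)" if "L n" for n
  proof -
    from that obtain u p v where "apath u p v" "length p = n"
      by (auto simp: L_def)
    then have "Suc n = card (set (awalk_verts u p))" "set (awalk_verts u p) \<subseteq> pverts F"
      by (auto simp: apath_def distinct_card length_awalk_verts[symmetric] simp flip: awalk_verts_with_proj_eq)
    then show ?thesis
      using card_mono[of "pverts F"] by (metis Suc_leD finite_verts with_proj_simps(1))
  qed
  ultimately obtain n where "L n" and max: "\<And>k. L k \<Longrightarrow> k \<le> n"
    using Greatest_le_nat[of L] GreatestI_nat[of L] by blast
  then obtain u p v where p: "apath u p v" "set (awalk_verts u p) \<subseteq> S" "length p = n"
    by (auto simp: L_def)
  have "u \<in> S"
    using p hd_in_awalk_verts by blast
  \<comment> \<open>\<open>snd (hd p)\<close> is the second vertex of a nonempty path;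
    \<open>x\<close> avoids it.\<close>
  then obtain x where x: "x \<in> S" "(u, x) \<in> parcs F" "p \<noteq> [] \<Longrightarrow> x \<noteq> snd (hd p)"
    using two[of u "snd (hd p)"] by auto
  have xu: "(x, u) \<in> parcs F" "x \<noteq> u"
    using x(2) arcs_symmetric no_loops' by auto
  have "x \<in> set (awalk_verts u p)"
  proof (rule ccontr)
    assume "x \<notin> set (awalk_verts u p)"
    then have "apath x ((x, u) # p) v" "set (awalk_verts x ((x, u) # p)) \<subseteq> S"
      using p x xu by (auto simp: apath_Cons_iff)
    then have "L (Suc n)"
      using p(3) unfolding L_def by force
    then show False
      using max by fastforce
  qed
  then obtain q r where qr: "p = q @ r" "awalk u q x" "awalk x r v"
    using awalk_decomp p(1) by (metis awalkI_apath)
  have "awlast u q = x"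
    using qr(2) by auto
  have "apath u (q @ r) v"
    using p(1) qr(1) by simp
  then have "apath u q x"
    using \<open>awlast u q = x\<close> by (simp add: apath_append_iff)
  have "awalk x ((x, u) # q) x"
    using xu qr(2) by (simp add: awalk_Cons_iff)
  moreover have "distinct (tl (awalk_verts x ((x, u) # q)))"
    using \<open>apath u q x\<close> by (simp add: apath_def)
  ultimately have "cycle ((x, u) # q)"
    by (auto simp: cycle_def)
  \<comment> \<open>An empty \<open>q\<close> would give \<open>x = u\<close>, and a single arc
    would make \<open>x\<close> the second vertex of the path.\<close>
  moreover have "3 \<le> length ((x, u) # q)"
  proof (rule ccontr)
    assume "\<not> ?thesis"
    then consider "q = []" | a where "q = [a]"
      by (cases q rule: list.exhaust; cases "tl q") auto
    then show False
    proof cases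
      case 1
      then show False
        using qr(2) xu(2) by (simp add: awalk_Nil_iff)
    next
      case 2
      then show False
        using qr(1,2) x(3) by (auto simp: awalk_simps)
    qed
  qed
  ultimately show False
    using assms(1) by (auto simp: is_forest_def)
qed

text \<open>Remove a leaf of \<open>S\<close>, root the rest, and hang the leaf one rank above its
  only neighbour; without a neighbour it becomes a root.\<close>

lemma forest_rooting:
  assumes "is_forest F" "S \<subseteq> pverts F"
  shows "\<exists>par (rk :: 'a \<Rightarrow> nat).
           (\<forall>x\<in>S. \<forall>y. par x = Some y \<longrightarrow> y \<in> S \<and> (x, y) \<in> parcs F \<and> rk y < rk x) \<and>
           (\<forall>x\<in>S. \<forall>y\<in>S. (x, y) \<in> parcs F \<longrightarrow> par x = Some y \<or> par y = Some x)"
proof -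
  interpret pair_graph F
    using assms(1) by (simp add: is_forest_def)
  have "finite S"
    using assms(2) finite_verts by (auto intro: finite_subset)
  then show ?thesis
    using assms(2)
  proof (induction S rule: finite_psubset_induct)
    case (psubset S)
    show ?case
    proof (cases "S = {}")
      case True
      then show ?thesis by auto
    next
      case False
      then obtain x where x: "x \<in> S"
        and leaf: "\<And>y z. y \<in> S \<Longrightarrow> z \<in> S \<Longrightarrow> (x, y) \<in> parcs F \<Longrightarrow> (x, z) \<in> parcs F \<Longrightarrow> y = z"
        using forest_has_leaf[OF assms(1) psubset.prems] by blast
      have "S - {x} \<subset> S" "S - {x} \<subseteq> pverts F"
        using x psubset.prems by auto
      from psubset.IH[OF this] obtain par and rk :: "'a \<Rightarrow> nat" where
        "(\<forall>u\<in>S - {x}. \<forall>y. par u = Some y \<longrightarrow> y \<in> S - {x} \<and> (u, y) \<in> parcs F \<and> rk y < rk u) \<and>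
         (\<forall>u\<in>S - {x}. \<forall>y\<in>S - {x}. (u, y) \<in> parcs F \<longrightarrow> par u = Some y \<or> par y = Some u)"
        by (elim exE)
      then have par: "\<And>u y. u \<in> S - {x} \<Longrightarrow> par u = Some y \<Longrightarrow> y \<in> S - {x} \<and> (u, y) \<in> parcs F \<and> rk y < rk u"
        and adj: "\<And>u y. u \<in> S - {x} \<Longrightarrow> y \<in> S - {x} \<Longrightarrow> (u, y) \<in> parcs F \<Longrightarrow> par u = Some y \<or> par y = Some u"
        by blast+
      have sym: "(a, b) \<in> parcs F \<Longrightarrow> (b, a) \<in> parcs F" for a b
        using arcs_symmetric by auto
      have irr: "(a, a) \<notin> parcs F" for a
        using no_loops'[of a a] by blast
      define nb where "nb z \<longleftrightarrow> z \<in> S \<and> (x, z) \<in> parcs F" for z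
      define par' where "par' = par(x := if Ex nb then Some (Eps nb) else None)"
      define rk' where "rk' = rk(x := Suc (rk (Eps nb)))"
      have par'_x: "par' x = Some z \<longleftrightarrow> nb z" for z
      proof -
        have "nb (Eps nb)" if "nb z"
          using that by (rule someI)
        moreover have "nb z \<Longrightarrow> nb z' \<Longrightarrow> z = z'" for z'
          using leaf by (auto simp: nb_def)
        ultimately show ?thesis
          by (auto simp: par'_def intro: someI)
      qed
      have nb_ne: "nb z \<Longrightarrow> z \<noteq> x" for z
        using irr by (auto simp: nb_def)
      have "y \<in> S \<and> (u, y) \<in> parcs F \<and> rk' y < rk' u" if "u \<in> S" "par' u = Some y" for u y
      proof (cases "u = x")
        case True
        then have "nb y" "y = Eps nb" "y \<noteq> x"
          using that(2) par'_x nb_ne by (auto simp: par'_def split: if_splits)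
        then show ?thesis
          using True by (auto simp: nb_def rk'_def)
      next
        case False
        then show ?thesis
          using that par[of u y] by (auto simp: par'_def rk'_def)
      qed
      moreover have "par' u = Some y \<or> par' y = Some u" if "u \<in> S" "y \<in> S" "(u, y) \<in> parcs F" for u y
      proof (cases "u = x \<or> y = x")
        case True
        then show ?thesis
          using that sym par'_x by (auto simp: nb_def)
      next
        case False
        then show ?thesis
          using that adj[of u y] by (auto simp: par'_def)
      qed
      ultimately show ?thesis
        by blast
    qed
  qed
qed

section \<open>Distances and the marking game\<close>

text \<open>A path repeats no vertex, so it never returns along the arc just used; that it avoids
  \<open>x\<close> allows its first step.\<close>

lemma (in pair_graph) apath_in_branch:
  assumes "apath u p w" "x \<notin> set (awalk_verts u p)" "length p \<le> d"
  shows "w \<in> branch (\<lambda>u. {y. (u, y) \<in> parcs G}) d x u"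
  using assms
proof (induction p arbitrary: u x d)
  case Nil
  then show ?case
    by (cases d) (auto simp: apath_Nil_iff)
next
  case (Cons a p)
  then obtain y d' where a: "a = (u, y)" "(u, y) \<in> parcs G" "apath y p w"
    "u \<notin> set (awalk_verts y p)" "d = Suc d'"
    by (cases a; cases d) (auto simp: apath_Cons_iff)
  moreover have "y \<noteq> x"
    using Cons.prems a hd_in_awalk_verts(2)[of y p w] by auto
  moreover have "w \<in> branch (\<lambda>u. {y. (u, y) \<in> parcs G}) d' u y"
    using Cons a by auto
  ultimately show ?case
    by auto
qed

lemma (in pair_graph) graph_power_arc_in_branch:
  assumes "(v, w) \<in> parcs (graph_power G (Suc d))"
  shows "w \<in> (\<Union>y\<in>{y. (v, y) \<in> parcs G}. branch (\<lambda>u. {y. (u, y) \<in> parcs G}) d v y)"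
proof -
  have vw: "v \<noteq> w" "\<mu> (\<lambda>_. 1) v w \<le> ereal (real (Suc d))"
    using assms by (auto simp: graph_power_def graph_dist_def)
  then have "\<mu> (\<lambda>_. 1) v w < \<infinity>"
    by auto
  \<comment> \<open>A finite distance is attained by a path, whose unit-cost sum is its
    length.\<close>
  then obtain p where p: "apath v p w" "\<mu> (\<lambda>_. 1) v w = awalk_cost (\<lambda>_. 1) p"
    unfolding \<mu>_reach_conv using min_cost_awalk[of v w "\<lambda>_. 1"] by auto
  have "awalk_cost (\<lambda>_. 1) p = length p"
    by (induction p) (auto simp: awalk_cost_def)
  then have len: "length p \<le> Suc d"
    using p(2) vw(2) by auto
  obtain y q where "p = (v, y) # q" "(v, y) \<in> parcs G" "apath y q w" "v \<notin> set (awalk_verts y q)"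
    using p(1) vw(1) by (cases p) (auto simp: apath_simps)
  then show ?thesis
    using apath_in_branch[of y q w v d] len by auto
qed

section \<open>From invariants of positions to bounds on the score\<close>

lemma back_degree_marking_order:
  assumes "distinct xs" "j < length xs" "\<And>v. (v, v) \<notin> parcs G"
  shows "back_degree G (marking_order xs) (xs ! j) \<le> card {w \<in> set (take j xs). (xs ! j, w) \<in> parcs G}"
  unfolding back_degree_def
proof (intro card_mono subsetI)
  fix w
  assume "w \<in> {w \<in> pverts G. (xs ! j, w) \<in> parcs G \<and> (w, xs ! j) \<in> marking_order xs}"
  then obtain i k where w: "(xs ! j, w) \<in> parcs G" "w = xs ! i"
    and ik: "xs ! j = xs ! k" "i \<le> k" "k < length xs"
    by (auto simp: marking_order_def)
  have "k = j"
    using assms(1,2) ik nth_eq_iff_index_eq by metis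
  moreover have "i \<noteq> j"
    using w assms(3) by auto
  ultimately have "i < j"
    using ik(2) by simp
  then have "w \<in> set (take j xs)"
    unfolding w(2) using assms(2) nth_mem[of i "take j xs"] by simp
  then show "w \<in> {w \<in> set (take j xs). (xs ! j, w) \<in> parcs G}"
    using w(1) by simp
qed simp

text \<open>
  Before a move of Alice, Bob may have added one vertex to a set satisfying \<open>Q\<close>; this costs the
  additional 1 in the bound on the back degree.
\<close>

lemma alice_guarantees_if_invariant:
  assumes fin: "finite (pverts G)" and irrefl: "\<And>v. (v, v) \<notin> parcs G"
    and Q_empty: "Q {}"
    and Q_alice: "\<And>M. Q M \<Longrightarrow> M \<subset> pverts G \<Longrightarrow> \<exists>u\<in>pverts G - M. Q (insert u M)"
    and Q_bob_alice: "\<And>M w. Q M \<Longrightarrow> w \<in> pverts G - M \<Longrightarrow> insert w M \<subset> pverts G \<Longrightarrow>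
        \<exists>u\<in>pverts G - insert w M. Q (insert u (insert w M))"
    and Q_card: "\<And>M v. Q M \<Longrightarrow> v \<in> pverts G - M \<Longrightarrow> card {w \<in> M. (v, w) \<in> parcs G} \<le> b"
  shows "alice_guarantees G (b + 2)"
proof -
  let ?V = "pverts G"
  \<comment> \<open>Alice preserves \<open>Q\<close> whenever possible; otherwise any legal move
    will do, so the strategy is legal in every position.\<close>
  define good where "good M u \<longleftrightarrow> u \<in> ?V - M \<and> ((\<exists>u\<in>?V - M. Q (insert u M)) \<longrightarrow> Q (insert u M))" for M u
  define \<sigma> where "\<sigma> xs = (SOME u. good (set xs) u)" for xs
  have \<sigma>: "good (set xs) (\<sigma> xs)" if "set xs \<subset> ?V" for xs
  proof -
    have "\<exists>u. good (set xs) u"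
      using that unfolding good_def by (cases "\<exists>u\<in>?V - set xs. Q (insert u (set xs))") auto
    then show ?thesis
      unfolding \<sigma>_def by (rule someI_ex)
  qed
  have "score G (marking_order xs) \<le> b + 2" if "complete_play ?V \<sigma> xs" for xs
  proof -
    have dist: "distinct xs" and V: "set xs = ?V"
      and play: "\<And>i. i < length xs \<Longrightarrow> even i \<Longrightarrow> xs ! i = \<sigma> (take i xs)"
      using that by (auto simp: complete_play_def)
    have new: "xs ! j \<in> ?V - set (take j xs)" if "j < length xs" for j
      using that dist V nth_mem[OF that] id_take_nth_drop[OF that]
      by (metis Diff_iff distinct_append disjoint_insert(1) list.simps(15) not_distinct_conv_prefix)
    have psub: "set (take j xs) \<subset> ?V" if "j < length xs" for j
      using new[OF that] set_take_subset[of j xs] V by blast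
    have step: "set (take (Suc j) xs) = insert (xs ! j) (set (take j xs))" if "j < length xs" for j
      using that by (simp add: take_Suc_conv_app_nth)
    have alice: "Q (set (take (Suc j) xs))"
      if "j < length xs" "even j" "\<exists>u\<in>?V - set (take j xs). Q (insert u (set (take j xs)))" for j
      using \<sigma>[OF psub[OF that(1)]] play[OF that(1,2)] that step[OF that(1)] by (simp add: good_def)
    have Q_odd: "Q (set (take (Suc (2 * i)) xs))" if "2 * i < length xs" for i
      using that
    proof (induction i)
      case 0
      then show ?case
        using Q_alice[OF Q_empty] psub[of 0] by (intro alice) auto
    next
      case (Suc i)
      let ?j = "Suc (2 * i)"
      have "?j < length xs" "2 * i < length xs" "Suc ?j < length xs"
        using Suc.prems by auto
      then show ?case
        using alice[of "Suc ?j"] Q_bob_alice[OF Suc.IH new[of ?j]] psub[of "Suc ?j"] step[of ?j]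
        by simp
    qed
    have "back_degree G (marking_order xs) v \<le> Suc b" if "v \<in> ?V" for v
    proof -
      from that V obtain j where j: "j < length xs" "v = xs ! j"
        by (metis in_set_conv_nth)
      let ?B = "\<lambda>j. {w \<in> set (take j xs). (v, w) \<in> parcs G}"
      have "card (?B j) \<le> Suc b"
      proof (cases "odd j")
        case True
        then obtain i where "j = Suc (2 * i)"
          by (auto elim: oddE)
        then show ?thesis
          using Q_card[OF Q_odd[of i], of v] new[OF j(1)] j by simp
      next
        \<comment> \<open>Alice marked \<open>v\<close>: since her previous move, if any, only Bob's
          vertex \<open>xs ! j'\<close> was added.\<close>
        case even: False
        show ?thesis
        proof (cases j)
          case 0
          then show ?thesis by simp
        next
          case (Suc j')
          then obtain i where i: "j' = Suc (2 * i)"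
            using even by (auto elim: oddE)
          have "v \<in> ?V - set (take j' xs)"
            using new[OF j(1)] step[of j'] j Suc by auto
          then have "card (?B j') \<le> b"
            using Q_card[OF Q_odd[of i], of v] i j Suc by simp
          moreover have "?B j \<subseteq> insert (xs ! j') (?B j')"
            using step[of j'] j Suc by auto
          then have "card (?B j) \<le> card (insert (xs ! j') (?B j'))"
            by (intro card_mono) auto
          moreover have "\<dots> \<le> Suc (card (?B j'))"
            by (simp add: card_insert_if)
          ultimately show ?thesis
            by linarith
        qed
      qed
      then show ?thesis
        using back_degree_marking_order[OF dist j(1) irrefl] j(2) by (auto intro: order_trans)
    qed
    then show ?thesis
      using fin by (simp add: score_def)
  qed
  moreover have "alice_strategy ?V \<sigma>"
    using \<sigma> unfolding alice_strategy_def good_def by blast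
  ultimately show ?thesis
    by (auto simp: alice_guarantees_def)
qed

section \<open>The bound for powers of a forest\<close>

lemma game_col_graph_power_forest:
  assumes "is_forest F" and deg: "\<And>v. v \<in> pverts F \<Longrightarrow> out_degree (with_proj F) v \<le> Suc k"
  shows "game_col (graph_power F m) \<le> (\<Sum>i<m. k ^ i) + 2 ^ m + 1"
proof -
  interpret pair_graph F
    using assms(1) by (simp add: is_forest_def)
  obtain par and rk :: "'a \<Rightarrow> nat" where
    par: "\<And>x y. x \<in> pverts F \<Longrightarrow> par x = Some y \<Longrightarrow> y \<in> pverts F \<and> (x, y) \<in> parcs F \<and> rk y < rk x"
    and adj: "\<And>x y. x \<in> pverts F \<Longrightarrow> y \<in> pverts F \<Longrightarrow> (x, y) \<in> parcs F \<Longrightarrow> par x = Some y \<or> par y = Some x"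
    using forest_rooting[OF assms(1) subset_refl] by blast
  interpret rooted_forest "pverts F" par rk
  proof unfold_locales
    show "finite (pverts F)"
      using finite_verts by simp
  qed (use par in blast)+
  have nbs_eq: "nbs = (\<lambda>x. {y. (x, y) \<in> parcs F})"
  proof (intro ext set_eqI iffI)
    show "y \<in> {y. (x, y) \<in> parcs F}" if "y \<in> nbs x" for x y
      using that par[of x y] par[of y x] arcs_symmetric[of y x] by (auto simp: nbs_def)
    show "y \<in> nbs x" if "y \<in> {y. (x, y) \<in> parcs F}" for x y
      using that adj[of x y] wellformed'[of x y] by (simp add: nbs_def)
  qed
  have deg_nbs: "card (nbs u) \<le> Suc k" for u
  proof (cases "u \<in> pverts F")
    case True
    have "out_arcs (with_proj F) u = Pair u ` nbs u"
      by (auto simp: nbs_eq out_arcs_def)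
    then have "out_degree (with_proj F) u = card (nbs u)"
      by (simp add: out_degree_def card_image inj_on_def)
    then show ?thesis
      using deg[OF True] by simp
  qed (simp add: nbs_def)
  let ?G = "graph_power F m"
  \<comment> \<open>The 1 saved in \<open>card_marked_near\<close> is subtracted here, exactly since
    \<open>2 ^ m\<close> is positive. Bob's extra vertex and the 1 in the score then add 2.\<close>
  let ?b = "(\<Sum>i<m. k ^ i) + 2 ^ m - 1"
  have V: "pverts ?G = pverts F"
    by (simp add: graph_power_def)
  have "alice_guarantees ?G (?b + 2)"
  proof (rule alice_guarantees_if_invariant[where Q = settled])
    show "finite (pverts ?G)"
      using finite_verts V by simp
    show "(v, v) \<notin> parcs ?G" for v
      by (simp add: graph_power_def)
    show "settled {}"
      using activation_empty by (auto simp: settled_def)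
    show "\<exists>u\<in>pverts ?G - M. settled (insert u M)" if "settled M" "M \<subset> pverts ?G" for M
      using settled_alice[of M] that V by auto
    show "\<exists>u\<in>pverts ?G - insert w M. settled (insert u (insert w M))"
      if "settled M" "w \<in> pverts ?G - M" "insert w M \<subset> pverts ?G" for M w
      using settled_bob_alice[of M w] that V by auto
    show "card {w \<in> M. (v, w) \<in> parcs ?G} \<le> ?b" if "settled M" "v \<in> pverts ?G - M" for M v
    \<comment> \<open>The first step from \<open>v\<close> uses one unit of distance, so branches
      have depth \<open>m - 1\<close>; the edgeless power \<open>m = 0\<close> is separate.\<close>
    proof (cases m)
      case 0
      have "parcs ?G = {}"
        using 0 by (auto simp: graph_power_def dest: order_trans)
      then show ?thesis
        by simp
    next
      case (Suc d)
      let ?N = "\<Union>y\<in>nbs v. branch nbs d v y"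
      have "finite (M \<inter> ?N)"
        by (auto intro: finite_nbs finite_branch)
      then have "card {w \<in> M. (v, w) \<in> parcs ?G} \<le> card (M \<inter> ?N)"
        using graph_power_arc_in_branch[of v _ d] unfolding Suc nbs_eq by (intro card_mono) auto
      moreover have "Suc (card (M \<inter> ?N)) \<le> (\<Sum>i\<le>d. k ^ i) + 2 ^ Suc d"
        using that V by (intro card_marked_near deg_nbs) auto
      ultimately show ?thesis
        by (simp add: Suc lessThan_Suc_atMost)
    qed
  qed
  then have "game_col ?G \<le> ?b + 2"
    unfolding game_col_def by (rule Least_le)
  moreover have "?b + 2 = (\<Sum>i<m. k ^ i) + 2 ^ m + 1"
    by simp
  ultimately show ?thesis
    by simp
qed

theorem theorem2:
  fixes F :: "'a pair_pre_digraph" and \<Delta> m :: nat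
  assumes "is_forest F"
    and "max_degree F = \<Delta>"
    and "\<Delta> \<ge> 3"
  shows "real (game_col (graph_power F m))
           \<le> ((real \<Delta> - 1) ^ m - 1) / (real \<Delta> - 2) + 2 ^ m + 1"
proof -
  interpret pair_graph F
    using assms(1) by (simp add: is_forest_def)
  have "out_degree (with_proj F) v \<le> Suc (\<Delta> - 1)" if "v \<in> pverts F" for v
    using that assms(2,3) finite_verts by (auto simp: max_degree_def intro!: Max_ge)
  then have "game_col (graph_power F m) \<le> (\<Sum>i<m. (\<Delta> - 1) ^ i) + 2 ^ m + 1"
    by (rule game_col_graph_power_forest[OF assms(1)])
  then have "real (game_col (graph_power F m)) \<le> real ((\<Sum>i<m. (\<Delta> - 1) ^ i) + 2 ^ m + 1)"
    by (rule of_nat_mono)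
  also have "\<dots> = (\<Sum>i<m. (real \<Delta> - 1) ^ i) + 2 ^ m + 1"
    using assms(3) by (simp add: of_nat_diff)
  also have "(\<Sum>i<m. (real \<Delta> - 1) ^ i) = ((real \<Delta> - 1) ^ m - 1) / (real \<Delta> - 2)"
    using assms(3) geometric_sum[of "real \<Delta> - 1" m] by simp
  finally show ?thesis .
qed

end
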